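(* Let $T,S\in\mathbb{B}_A(\mathcal{H})$ and let $N_A$ be a seminorm on $\mathbb{B}_{A^{1/2}}(\mathcal{H})$ which is $A$-selfadjoint invariant and submultiplicative. Then (for each choice of sign) $$\omega_{N_A}(TS)\le N_A(T)\,\omega_{N_A}(S)+\frac12\,\omega_{N_A}(TS\pm ST^{\sharp_A}),$$ and $$\omega_{N_A}(TS)\le N_A(S)\,\omega_{N_A}(T)+\frac12\,\omega_{N_A}(TS\pm S^{\sharp_A}T).$$
   Context: $\mathcal{H}$ is a complex Hilbert space with inner product $\langle\cdot,\cdot\rangle$, $\mathbb{B}(\mathcal{H})$ is the algebra of bounded linear operators on $\mathcal{H}$, and $A\in\mathbb{B}(\mathcal{H})$ is a non-zero positive operator ($\langle Ax,x\rangle\ge 0$ for all $x$). Put $\|x\|_A=\sqrt{\langle Ax,x\rangle}$. $\mathbb{B}_A(\mathcal{H})$ is the set of $T\in\mathbb{B}(\mathcal{H})$ with $\mathcal{R}(T^*A)\subseteq\mathcal{R}(A)$ ($\mathcal{R}$ denotes range). $\mathbb{B}_{A^{1/2}}(\mathcal{H})$ is the set of $T\in\mathbb{B}(\mathcal{H})$ for which there is $c>0$ with $\|Tx\|_A\le c\|x\|_A$ for all $x\in\mathcal{H}$. Both are subalgebras of $\mathbb{B}(\mathcal{H})$ and $\mathbb{B}_A(\mathcal{H})\subseteq\mathbb{B}_{A^{1/2}}(\mathcal{H})$. For $T\in\mathbb{B}_A(\mathcal{H})$, $T^{\sharp_A}$ is the unique $X\in\mathbb{B}(\mathcal{H})$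 with $AX=T^*A$ and $\mathcal{R}(X)\subseteq\overline{\mathcal{R}(A)}$; one has $T^{\sharp_A}\in\mathbb{B}_A(\mathcal{H})$. Put $\Re_A(T)=\frac{T+T^{\sharp_A}}{2}$. For a seminorm $N_A$, $\omega_{N_A}(T)=\sup_{\theta\in\mathbb{R}}N_A\big(\Re_A(e^{i\theta}T)\big)$ for $T\in\mathbb{B}_A(\mathcal{H})$. $N_A$ is $A$-selfadjoint invariant if $N_A(T)=N_A(T^{\sharp_A})$ for all $T\in\mathbb{B}_A(\mathcal{H})$, and submultiplicative if $N_A(TS)\le N_A(T)N_A(S)$ for all $T,S\in\mathbb{B}_{A^{1/2}}(\mathcal{H})$. *)

theory Defs
  imports "HOL-Analysis.Analysis"
begin

text \<open>
  Complex Hilbert spaces as a type class on top of the library's real inner product spaces.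
  The complex inner product is linear in its first argument, and the real structure (scaling,
  inner product, hence norm and topology) is the one induced by the complex structure; positive
  definiteness is inherited through \<open>inner x x = Re (cinner x x)\<close>.
\<close>

class chilbert_space = real_inner + banach +
  fixes scaleC :: "complex \<Rightarrow> 'a \<Rightarrow> 'a"  (infixr \<open>*\<^sub>C\<close> 75)
    and cinner :: "'a \<Rightarrow> 'a \<Rightarrow> complex"
  assumes scaleC_add_right: "c *\<^sub>C (x + y) = c *\<^sub>C x + c *\<^sub>C y"
    and scaleC_add_left: "(c + d) *\<^sub>C x = c *\<^sub>C x + d *\<^sub>C x"
    and scaleC_scaleC: "c *\<^sub>C d *\<^sub>C x = (c * d) *\<^sub>C x"
    and scaleR_scaleC: "r *\<^sub>R x = complex_of_real r *\<^sub>C x"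
    and cinner_add_left: "cinner (x + y) z = cinner x z + cinner y z"
    and cinner_scaleC_left: "cinner (c *\<^sub>C x) y = c * cinner x y"
    and cinner_commute: "cinner x y = cnj (cinner y x)"
    and inner_eq_Re_cinner: "inner x y = Re (cinner x y)"

instantiation complex :: chilbert_space
begin

definition scaleC_complex :: "complex \<Rightarrow> complex \<Rightarrow> complex"
  where "scaleC_complex c x = c * x"

definition cinner_complex :: "complex \<Rightarrow> complex \<Rightarrow> complex"
  where "cinner_complex x y = x * cnj y"

instance
  by standard
    (auto simp: scaleC_complex_def cinner_complex_def scaleR_conv_of_real inner_complex_def
      algebra_simps)

end

lemma norm_scaleC: "norm (c *\<^sub>C x) = cmod c * norm (x :: 'h::chilbert_space)"
proof -
  have "cinner (c *\<^sub>C x) (c *\<^sub>C x) = c * cnj c * cinner x x"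
    by (metis cinner_commute cinner_scaleC_left complex_cnj_mult mult.assoc mult.left_commute)
  also have "c * cnj c = complex_of_real ((cmod c)\<^sup>2)"
    by (metis complex_norm_square of_real_power)
  finally have "inner (c *\<^sub>C x) (c *\<^sub>C x) = (cmod c)\<^sup>2 * inner x x"
    by (simp add: inner_eq_Re_cinner)
  then show ?thesis
    by (simp add: norm_eq_sqrt_inner real_sqrt_mult)
qed

lemma bounded_linear_scaleC: "bounded_linear (scaleC c :: 'h::chilbert_space \<Rightarrow> 'h)"
proof (rule bounded_linear_intro[where K = "cmod c"])
  show "c *\<^sub>C r *\<^sub>R x = r *\<^sub>R c *\<^sub>C x" for r and x :: 'h
    by (simp add: scaleR_scaleC scaleC_scaleC mult.commute)
qed (simp_all add: scaleC_add_right norm_scaleC mult.commute)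

text \<open>
  The library type \<open>'h \<Rightarrow>\<^sub>L 'h\<close> consists of the bounded real-linear operators, with their
  addition, real scaling, operator norm and composition; the algebra of bounded complex-linear
  operators is the following subset.
\<close>

definition cbounded_ops :: "('h::chilbert_space \<Rightarrow>\<^sub>L 'h) set"
  where "cbounded_ops = {T. \<forall>c x. blinfun_apply T (c *\<^sub>C x) = c *\<^sub>C blinfun_apply T x}"

lift_definition op_scaleC :: "complex \<Rightarrow> ('h::chilbert_space \<Rightarrow>\<^sub>L 'h) \<Rightarrow> ('h \<Rightarrow>\<^sub>L 'h)"
  is "\<lambda>c T x. c *\<^sub>C T x"
  using bounded_linear_compose[OF bounded_linear_scaleC] .

definition op_adj :: "('h::chilbert_space \<Rightarrow>\<^sub>L 'h) \<Rightarrow> ('h \<Rightarrow>\<^sub>L 'h)"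
  where "op_adj T = (THE S. \<forall>x y. cinner (blinfun_apply T x) y = cinner x (blinfun_apply S y))"

definition positive_op :: "('h::chilbert_space \<Rightarrow>\<^sub>L 'h) \<Rightarrow> bool"
  where "positive_op A \<longleftrightarrow> A \<in> cbounded_ops \<and> (\<forall>x. cinner (blinfun_apply A x) x \<in> \<real>\<^sub>\<ge>\<^sub>0)"

text \<open>For positive \<open>A\<close> the value \<open>cinner (A x) x\<close> is real, so \<open>Re\<close> only changes its type.\<close>

definition A_norm :: "('h::chilbert_space \<Rightarrow>\<^sub>L 'h) \<Rightarrow> 'h \<Rightarrow> real"
  where "A_norm A x = sqrt (Re (cinner (blinfun_apply A x) x))"

definition B_A :: "('h::chilbert_space \<Rightarrow>\<^sub>L 'h) \<Rightarrow> ('h \<Rightarrow>\<^sub>L 'h) set"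
  where "B_A A = {T \<in> cbounded_ops.
    range (blinfun_apply (op_adj T o\<^sub>L A)) \<subseteq> range (blinfun_apply A)}"

definition B_A_half :: "('h::chilbert_space \<Rightarrow>\<^sub>L 'h) \<Rightarrow> ('h \<Rightarrow>\<^sub>L 'h) set"
  where "B_A_half A = {T \<in> cbounded_ops.
    \<exists>c>0. \<forall>x. A_norm A (blinfun_apply T x) \<le> c * A_norm A x}"

definition A_adj :: "('h::chilbert_space \<Rightarrow>\<^sub>L 'h) \<Rightarrow> ('h \<Rightarrow>\<^sub>L 'h) \<Rightarrow> ('h \<Rightarrow>\<^sub>L 'h)"
  where "A_adj A T = (THE X. X \<in> cbounded_ops \<and> A o\<^sub>L X = op_adj T o\<^sub>L A \<and>
    range (blinfun_apply X) \<subseteq> closure (range (blinfun_apply A)))"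

definition A_Re :: "('h::chilbert_space \<Rightarrow>\<^sub>L 'h) \<Rightarrow> ('h \<Rightarrow>\<^sub>L 'h) \<Rightarrow> ('h \<Rightarrow>\<^sub>L 'h)"
  where "A_Re A T = (1 / 2) *\<^sub>R (T + A_adj A T)"

definition seminorm_on :: "('h::chilbert_space \<Rightarrow>\<^sub>L 'h) set \<Rightarrow> (('h \<Rightarrow>\<^sub>L 'h) \<Rightarrow> real) \<Rightarrow> bool"
  where "seminorm_on V N \<longleftrightarrow>
    (\<forall>T\<in>V. 0 \<le> N T) \<and>
    (\<forall>c. \<forall>T\<in>V. N (op_scaleC c T) = cmod c * N T) \<and>
    (\<forall>T\<in>V. \<forall>S\<in>V. N (T + S) \<le> N T + N S)"

definition A_selfadjoint_invariant ::
    "('h::chilbert_space \<Rightarrow>\<^sub>L 'h) \<Rightarrow> (('h \<Rightarrow>\<^sub>L 'h) \<Rightarrow> real) \<Rightarrow> bool"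
  where "A_selfadjoint_invariant A N \<longleftrightarrow> (\<forall>T\<in>B_A A. N T = N (A_adj A T))"

definition A_submultiplicative ::
    "('h::chilbert_space \<Rightarrow>\<^sub>L 'h) \<Rightarrow> (('h \<Rightarrow>\<^sub>L 'h) \<Rightarrow> real) \<Rightarrow> bool"
  where "A_submultiplicative A N \<longleftrightarrow>
    (\<forall>T\<in>B_A_half A. \<forall>S\<in>B_A_half A. N (T o\<^sub>L S) \<le> N T * N S)"

text \<open>
  The supremum is taken in the reals.  For \<open>T \<in> B_A A\<close> and an \<open>A\<close>-selfadjoint invariant seminorm
  \<open>N\<close> on \<open>B_A_half A\<close> the family is bounded above by \<open>N T\<close>.
\<close>

definition A_num_radius ::
    "('h::chilbert_space \<Rightarrow>\<^sub>L 'h) \<Rightarrow> (('h \<Rightarrow>\<^sub>L 'h) \<Rightarrow> real) \<Rightarrow> ('h \<Rightarrow>\<^sub>L 'h) \<Rightarrow> real"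
  where "A_num_radius A N T =
    (SUP \<theta>::real. N (A_Re A (op_scaleC (exp (\<i> * complex_of_real \<theta>)) T)))"

end

theory Submission
  imports Defs
begin

text \<open>
  Write \<open>T\<^sup>\<sharp>\<close> for the \<open>A\<close>-adjoint, \<open>\<Re>\<close> for the \<open>A\<close>-real part and \<open>\<omega>\<close> for the numerical radius of the
  seminorm \<open>N\<close>. The inequalities are consequences of one estimate,
  \<open>\<omega> (T S \<plusminus> S T\<^sup>\<sharp>) \<le> 2 N(T) \<omega>(S)\<close>. Indeed \<open>T S\<close> is the midpoint of \<open>T S + S T\<^sup>\<sharp>\<close> and
  \<open>T S - S T\<^sup>\<sharp>\<close>, and \<open>\<omega>\<close> is subadditive, so estimating one of the two halves by \<open>N(T) \<omega>(S)\<close> leaves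
  half of the numerical radius of the other one (\<open>num_radius_midpoint\<close>). The second pair of
  inequalities is the first pair for \<open>S\<^sup>\<sharp>\<close> and \<open>T\<^sup>\<sharp>\<close>, because \<open>\<omega>(X\<^sup>\<sharp>) = \<omega>(X)\<close>.

  For the estimate with the sign \<open>+\<close> (\<open>num_radius_add_le\<close>), let \<open>c\<close> be a complex number of modulus \<open>1\<close>,
  \<open>X = c (T S + S T\<^sup>\<sharp>)\<close> and \<open>P = (\<Re> (c S))\<^sup>\<sharp>\<close>. Since \<open>T\<^sup>\<sharp>\<^sup>\<sharp>\<^sup>\<sharp> = T\<^sup>\<sharp>\<close>, one finds
  \<open>(\<Re> X)\<^sup>\<sharp> = T\<^sup>\<sharp>\<^sup>\<sharp> P + P T\<^sup>\<sharp>\<close>; as \<open>N\<close> is invariant under \<open>\<sharp>\<close> and submultiplicative, the value of \<open>N\<close> at the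
  left side is \<open>N(\<Re> X)\<close> and at the right side at most \<open>2 N(T) N(\<Re> (c S))\<close>. The sign \<open>-\<close> results from
  replacing \<open>T\<close> by \<open>\<i> T\<close>.

  The calculus of \<open>\<sharp>\<close> on which this rests requires that each operator of \<open>B_A A\<close> has a bounded
  \<open>A\<close>-adjoint (\<open>B_A_imp_A_adjoint_pair\<close>, from the Riesz representation theorem and uniform
  boundedness) and is bounded for the seminorm of \<open>A\<close>, so that \<open>N\<close> is a seminorm on \<open>B_A A\<close>
  (\<open>B_A_subset_B_A_half\<close>).
\<close>

section \<open>Complex inner products and bounded operators\<close>

lemma scaleC_neg_one: "(- 1) *\<^sub>C x = - (x :: 'h::chilbert_space)"
  by (metis of_real_1 of_real_minus scaleR_minus1_left scaleR_scaleC)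

lemma cinner_add_right: "cinner x (y + z) = cinner x y + cinner x (z :: 'h::chilbert_space)"
  by (metis cinner_add_left cinner_commute complex_cnj_add)

lemma cinner_scaleC_right: "cinner x (c *\<^sub>C y) = cnj c * cinner x (y :: 'h::chilbert_space)"
  by (metis cinner_commute cinner_scaleC_left complex_cnj_mult)

text \<open>The imaginary part of the complex inner product is again a value of the real one, so an
  identity between real inner products that is compatible with multiplication by \<open>\<i>\<close> is already
  an identity between complex inner products.\<close>

lemma cinner_eq_inner:
  "cinner x y = Complex (inner x y) (- inner (\<i> *\<^sub>C x) (y :: 'h::chilbert_space))"
  by (simp add: complex_eq_iff inner_eq_Re_cinner cinner_scaleC_left)

lemma cinner_eqI: "x = y" if "\<And>z. cinner x z = cinner y (z :: 'h::chilbert_space)"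
proof -
  have "inner x z = inner y z" for z
    by (simp add: inner_eq_Re_cinner that)
  then show ?thesis
    using inner_eq_zero_iff[of "x - y"] by (simp add: inner_diff_left)
qed

lemma cbounded_opsD: "T \<in> cbounded_ops \<Longrightarrow> T (c *\<^sub>C x) = c *\<^sub>C T x"
  by (simp add: cbounded_ops_def)

lemma cbounded_ops_add: "T \<in> cbounded_ops \<Longrightarrow> S \<in> cbounded_ops \<Longrightarrow> T + S \<in> cbounded_ops"
  by (simp add: cbounded_ops_def blinfun.add_left scaleC_add_right)

lemma cbounded_ops_scaleC: "T \<in> cbounded_ops \<Longrightarrow> op_scaleC c T \<in> cbounded_ops"
  by (simp add: cbounded_ops_def op_scaleC.rep_eq scaleC_scaleC mult.commute)

lemma cbounded_ops_compose: "T \<in> cbounded_ops \<Longrightarrow> S \<in> cbounded_ops \<Longrightarrow> T o\<^sub>L S \<in> cbounded_ops"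
  by (simp add: cbounded_ops_def)

lemma scaleR_op_scaleC: "r *\<^sub>R T = op_scaleC (complex_of_real r) T"
  by (rule blinfun_eqI) (simp add: op_scaleC.rep_eq scaleR_scaleC blinfun.scaleR_left)

lemma op_scaleC_op_scaleC: "op_scaleC c (op_scaleC d T) = op_scaleC (c * d) T"
  by (rule blinfun_eqI) (simp add: op_scaleC.rep_eq scaleC_scaleC)

lemma op_scaleC_add: "op_scaleC c (T + S) = op_scaleC c T + op_scaleC c S"
  by (rule blinfun_eqI) (simp add: op_scaleC.rep_eq blinfun.add_left scaleC_add_right)

lemma op_scaleC_compose_left: "op_scaleC c T o\<^sub>L S = op_scaleC c (T o\<^sub>L S)"
  by (rule blinfun_eqI) (simp add: op_scaleC.rep_eq)

lemma op_scaleC_compose_right: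
  "T \<in> cbounded_ops \<Longrightarrow> T o\<^sub>L op_scaleC c S = op_scaleC c (T o\<^sub>L S)"
  by (rule blinfun_eqI) (simp add: op_scaleC.rep_eq cbounded_opsD)

lemma op_scaleC_neg_one: "op_scaleC (- 1) T = - T"
  by (rule blinfun_eqI) (simp add: op_scaleC.rep_eq scaleC_neg_one blinfun.minus_left)

section \<open>The Riesz representation theorem on a closed subspace\<close>

text \<open>The representing vector minimises \<open>\<lambda>x. x \<bullet> x - 2 * f x\<close> over \<open>M\<close>: by the parallelogram law a
  minimising sequence is Cauchy, and at the minimum the derivative in each direction of \<open>M\<close>
  vanishes. For \<open>M = UNIV\<close> this is the usual representation theorem; for \<open>f = (\<bullet>) z\<close> it gives the
  orthogonal projection of \<open>z\<close> onto \<open>M\<close>.\<close>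

lemma Riesz_on_closed_subspace:
  fixes f :: "'a::{real_inner,banach} \<Rightarrow> real"
  assumes f: "bounded_linear f" and M: "subspace M" "closed M"
  obtains y where "y \<in> M" "\<And>h. h \<in> M \<Longrightarrow> inner y h = f h"
proof -
  interpret f: bounded_linear f by fact
  define J where "J x = inner x x - 2 * f x" for x
  define d where "d = Inf (J ` M)"
  obtain K where K: "\<bar>f x\<bar> \<le> norm x * K" for x
    using f.nonneg_bounded by (metis real_norm_def)
  have "- K\<^sup>2 \<le> J x" for x
  proof -
    have "0 \<le> (norm x - K)\<^sup>2" by simp
    then show ?thesis
      using K[of x] by (auto simp: J_def power2_eq_square algebra_simps simp flip: power2_norm_eq_inner)
  qed
  then have bdd: "bdd_below (J ` M)" by (auto intro!: bdd_belowI)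
  have ne: "J ` M \<noteq> {}" using subspace_0[OF M(1)] by auto
  have d_le: "d \<le> J x" if "x \<in> M" for x
    unfolding d_def using bdd that by (auto intro: cInf_lower)
  have "\<exists>x\<in>M. J x < d + inverse (Suc n)" for n
  proof -
    have "Inf (J ` M) < d + inverse (Suc n)" unfolding d_def[symmetric] by simp
    then show ?thesis using cInf_lessD[OF ne] by blast
  qed
  then obtain X where X: "X n \<in> M" "J (X n) < d + inverse (Suc n)" for n
    by metis
  have par: "(norm (x - y))\<^sup>2 \<le> 2 * (J x - d) + 2 * (J y - d)" if "x \<in> M" "y \<in> M" for x y
  proof -
    have "(1/2) *\<^sub>R (x + y) \<in> M"
      using that M(1) by (auto intro: subspace_add subspace_scale)
    from d_le[OF this] show ?thesis
      unfolding J_def power2_norm_eq_inner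
      by (simp add: inner_add_left inner_add_right inner_diff_left inner_diff_right f.add f.scaleR
          inner_commute[of y x] field_simps)
  qed
  have "Cauchy X"
  proof (rule metric_CauchyI)
    fix e :: real assume "0 < e"
    then obtain n0 where n0: "inverse (Suc n0) < e\<^sup>2 / 4"
      using reals_Archimedean[of "e\<^sup>2 / 4"] by auto
    have "dist (X m) (X n) < e" if "m \<ge> n0" "n \<ge> n0" for m n
    proof -
      have "J (X k) - d < e\<^sup>2 / 4" if "k \<ge> n0" for k
      proof -
        have "inverse (real (Suc k)) \<le> inverse (real (Suc n0))" using that by (intro le_imp_inverse_le) auto
        then show ?thesis using X(2)[of k] n0 by linarith
      qed
      from this[OF that(1)] this[OF that(2)] par[OF X(1)[of m] X(1)[of n]]
      have "(norm (X m - X n))\<^sup>2 < e\<^sup>2" by (simp add: field_simps)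
      then show ?thesis using \<open>0 < e\<close> by (simp add: dist_norm power2_less_imp_less)
    qed
    then show "\<exists>n0. \<forall>m\<ge>n0. \<forall>n\<ge>n0. dist (X m) (X n) < e" by blast
  qed
  then obtain y where y: "X \<longlonglongrightarrow> y" using Cauchy_convergent convergent_def by blast
  have yM: "y \<in> M" using closed_sequentially[OF M(2) X(1) y] .
  have "J y \<le> d"
  proof (rule LIMSEQ_le)
    show "(\<lambda>n. J (X n)) \<longlonglongrightarrow> J y"
      unfolding J_def by (intro tendsto_intros f.tendsto y)
    show "(\<lambda>n. d + inverse (Suc n)) \<longlonglongrightarrow> d"
      using tendsto_add[OF tendsto_const LIMSEQ_inverse_real_of_nat, of d] by simp
    show "\<exists>N. \<forall>n\<ge>N. J (X n) \<le> d + inverse (real (Suc n))"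
      using X(2) less_imp_le by blast
  qed
  have "inner y h = f h" if h: "h \<in> M" for h
  proof (rule ccontr)
    define a where "a = inner y h - f h"
    \<comment> \<open>Nearly the minimiser of \<open>\<lambda>t. J (y + t *\<^sub>R h)\<close>; the summand \<open>1\<close> keeps the denominator positive.\<close>
    define t where "t = - a / (inner h h + 1)"
    assume "inner y h \<noteq> f h"
    then have a: "a\<^sup>2 > 0" by (simp add: a_def)
    have hh: "inner h h \<ge> 0" by simp
    have "J y \<le> J (y + t *\<^sub>R h)"
      using \<open>J y \<le> d\<close> d_le[of "y + t *\<^sub>R h"] yM h M(1)
      by (force intro: subspace_add subspace_scale)
    also have "\<dots> = J y + 2 * t * a + t\<^sup>2 * inner h h"
      by (simp add: J_def a_def inner_add_left inner_add_right f.add f.scaleR inner_commute[of h y]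
          power2_eq_square algebra_simps)
    finally have "0 \<le> 2 * t * a + t\<^sup>2 * inner h h" by simp
    also have "\<dots> \<le> 2 * t * a + t\<^sup>2 * (inner h h + 1)"
      by (simp add: mult_left_mono)
    also have "\<dots> = - a\<^sup>2 / (inner h h + 1)"
      using hh by (simp add: t_def divide_simps power2_eq_square add_eq_0_iff)
    finally show False using a hh
      by (smt (verit) divide_neg_pos)
  qed
  with yM show ?thesis using that by blast
qed

section \<open>Uniform boundedness\<close>

text \<open>The closed sets on which the whole family is bounded by \<open>n\<close> cover the space, so by Baire one
  of them contains a ball; differences of points of this ball control the family near \<open>0\<close>.\<close>

lemma uniform_boundedness:
  fixes f :: "'i \<Rightarrow> 'a::banach \<Rightarrow> real"
  assumes lin: "\<And>i. i \<in> I \<Longrightarrow> bounded_linear (f i)"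
    and bdd: "\<And>x. \<exists>K. \<forall>i\<in>I. \<bar>f i x\<bar> \<le> K"
  obtains C where "\<And>i x. i \<in> I \<Longrightarrow> \<bar>f i x\<bar> \<le> C * norm x"
proof -
  define E where "E n = {x. \<forall>i\<in>I. \<bar>f i x\<bar> \<le> real n}" for n
  have clE: "closed (E n)" for n
  proof -
    have "E n = (\<Inter>i\<in>I. {x. \<bar>f i x\<bar> \<le> real n})" by (auto simp: E_def)
    moreover have "closed {x. \<bar>f i x\<bar> \<le> real n}" if "i \<in> I" for i
      using linear_continuous_on[OF lin[OF that]]
      by (intro closed_Collect_le continuous_intros) auto
    ultimately show ?thesis by auto
  qed
  have "\<Union>(range E) = UNIV"
  proof -
    have "\<exists>n. x \<in> E n" for x
    proof -
      obtain K where "\<forall>i\<in>I. \<bar>f i x\<bar> \<le> K" using bdd by blast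
      moreover obtain n where "K \<le> real n" using real_arch_simple by blast
      ultimately have "x \<in> E n" unfolding E_def by force
      then show ?thesis by blast
    qed
    then show ?thesis by auto
  qed
  have "\<exists>n. interior (E n) \<noteq> {}"
  proof (rule ccontr)
    assume "\<nexists>n. interior (E n) \<noteq> {}"
    then have "Met_TC.mtopology interior_of \<Union>(range E) = {}"
      using clE by (intro Met_TC.metric_Baire_category_alt) (auto simp: Met_TC.mcomplete_def convergent_eq_Cauchy)
    with \<open>\<Union>(range E) = UNIV\<close> show False by simp
  qed
  then obtain n x0 where "x0 \<in> interior (E n)" by auto
  then obtain r where r: "r > 0" "cball x0 r \<subseteq> E n"
    unfolding mem_interior_cball by blast
  have "\<bar>f i x\<bar> \<le> 2 * real n / r * norm x" if i: "i \<in> I" for i x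
  proof (cases "x = 0")
    case True
    then show ?thesis using linear_0[OF bounded_linear.linear[OF lin[OF i]]] by simp
  next
    case False
    interpret f: bounded_linear "f i" using lin i .
    define s where "s = r / norm x"
    have s: "s > 0" using r False by (simp add: s_def)
    have "x0 + s *\<^sub>R x \<in> E n" "x0 \<in> E n"
      using r False by (auto simp: dist_norm s_def subset_iff)
    then have "\<bar>f i (x0 + s *\<^sub>R x)\<bar> \<le> real n" "\<bar>f i x0\<bar> \<le> real n"
      using i by (auto simp: E_def)
    then have "\<bar>s * f i x\<bar> \<le> 2 * real n" by (simp add: f.add f.scaleR)
    then have "s * \<bar>f i x\<bar> \<le> 2 * real n" using s by (simp add: abs_mult)
    then show ?thesis using s False r by (simp add: s_def field_simps)
  qed
  then show ?thesis using that by blast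
qed

section \<open>Hilbert space adjoints\<close>

lemma op_adj:
  fixes T :: "'a::chilbert_space \<Rightarrow>\<^sub>L 'a"
  assumes T: "T \<in> cbounded_ops"
  shows cinner_op_adj: "cinner (T x) y = cinner x (op_adj T y)"
    and op_adj_cbounded: "op_adj T \<in> cbounded_ops"
proof -
  have "\<exists>z. \<forall>x. inner z x = inner y (T x)" for y
  proof -
    have "bounded_linear (\<lambda>x. inner y (T x))"
      by (intro bounded_linear_intros)
    from Riesz_on_closed_subspace[OF this, of UNIV] show ?thesis by auto
  qed
  then obtain g where g: "inner (g y) x = inner y (T x)" for x y by metis
  have "bounded_linear g"
  proof (rule bounded_linear_intro[where K = "norm T"])
    show "g (x + y) = g x + g y" for x y
      by (rule vector_eq_rdot[THEN iffD1]) (simp add: g inner_add_left)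
    show "g (r *\<^sub>R x) = r *\<^sub>R g x" for r x
      by (rule vector_eq_rdot[THEN iffD1]) (simp add: g)
    show "norm (g x) \<le> norm x * norm T" for x
    proof -
      have "norm (g x) * norm (g x) = inner x (T (g x))"
        using g[of x "g x"] by (simp add: power2_norm_eq_inner flip: power2_eq_square)
      also have "\<dots> \<le> norm x * (norm T * norm (g x))"
        by (meson Cauchy_Schwarz_ineq2 abs_le_D1 dual_order.trans mult_left_mono norm_blinfun norm_ge_zero)
      finally show ?thesis
        by (cases "norm (g x) = 0") (auto simp: mult_ac)
    qed
  qed
  define S where "S = Blinfun g"
  have S: "blinfun_apply S = g" unfolding S_def using \<open>bounded_linear g\<close> by (rule bounded_linear_Blinfun_apply)
  have adj: "cinner (T x) y = cinner x (S y)" for x y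
    unfolding cinner_eq_inner S using g[of y x] g[of y "\<i> *\<^sub>C x"]
    by (simp add: inner_commute cbounded_opsD[OF T])
  have "op_adj T = S"
    unfolding op_adj_def
  proof (rule the_equality)
    fix S' :: "'a \<Rightarrow>\<^sub>L 'a" assume S': "\<forall>x y. cinner (T x) y = cinner x (S' y)"
    have "S' y = S y" for y
      by (rule cinner_eqI) (metis S' adj cinner_commute)
    then show "S' = S" by (rule blinfun_eqI)
  qed (use adj in blast)
  with adj show adj': "cinner (T x) y = cinner x (op_adj T y)" for x y by simp
  have "op_adj T (c *\<^sub>C x) = c *\<^sub>C op_adj T x" for c x
  proof (rule cinner_eqI)
    fix z
    have "cinner z (op_adj T (c *\<^sub>C x)) = cinner z (c *\<^sub>C op_adj T x)"
      by (simp add: cinner_scaleC_right flip: adj')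
    then show "cinner (op_adj T (c *\<^sub>C x)) z = cinner (c *\<^sub>C op_adj T x) z"
      by (metis cinner_commute)
  qed
  then show "op_adj T \<in> cbounded_ops" by (simp add: cbounded_ops_def)
qed

section \<open>Pairs of operators that are adjoint for the semi-inner product of A\<close>

text \<open>\<open>X\<close> is adjoint to \<open>T\<close> with respect to the semi-inner product \<open>\<langle>A x, y\<rangle>\<close>. Such an \<open>X\<close> is unique
  only up to operators with range in the kernel of \<open>A\<close>; \<^const>\<open>A_adj\<close> selects the one whose range
  lies in the closure of the range of \<open>A\<close>. The relation is easier to calculate with than the
  selected adjoint, because it is symmetric in \<open>T\<close> and \<open>X\<close>.\<close>

definition A_adjoint_pair ::
    "('h::chilbert_space \<Rightarrow>\<^sub>L 'h) \<Rightarrow> ('h \<Rightarrow>\<^sub>L 'h) \<Rightarrow> ('h \<Rightarrow>\<^sub>L 'h) \<Rightarrow> bool"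
  where "A_adjoint_pair A T X \<longleftrightarrow> T \<in> cbounded_ops \<and> X \<in> cbounded_ops \<and>
    (\<forall>x y. cinner (A (T x)) y = cinner (A x) (X y))"

locale positive_operator =
  fixes A :: "'h::chilbert_space \<Rightarrow>\<^sub>L 'h"
  assumes pos: "positive_op A"
begin

lemma A_cbounded: "A \<in> cbounded_ops"
  using pos by (simp add: positive_op_def)

lemma A_scaleC: "A (c *\<^sub>C x) = c *\<^sub>C A x"
  using A_cbounded by (rule cbounded_opsD)

text \<open>Polarisation: the quadratic form of \<open>A\<close> is real at \<open>x + y\<close> and at \<open>x + \<i> y\<close>.\<close>

lemma cinner_A_symmetric: "cinner (A x) y = cinner x (A y)"
proof -
  have real: "Im (cinner (A x) x) = 0" for x
    using pos by (auto simp: positive_op_def complex_nonneg_Reals_iff)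
  have "Im (cinner (A x) y) + Im (cinner (A y) x) = 0"
    using real[of "x + y"] real[of x] real[of y]
    by (simp add: blinfun.add_right cinner_add_left cinner_add_right)
  moreover have "Re (cinner (A x) y) = Re (cinner (A y) x)"
    using real[of "x + \<i> *\<^sub>C y"] real[of x] real[of y]
    by (simp add: blinfun.add_right cinner_add_left cinner_add_right A_scaleC
        cinner_scaleC_left cinner_scaleC_right)
  ultimately have "cinner (A x) y = cnj (cinner (A y) x)"
    by (simp add: complex_eq_iff)
  then show ?thesis by (metis cinner_commute)
qed

lemma inner_A_symmetric: "inner (A x) y = inner x (A y)"
  by (simp add: inner_eq_Re_cinner cinner_A_symmetric)

lemma inner_A_nonneg: "0 \<le> inner (A x) x"
  using pos by (auto simp: positive_op_def complex_nonneg_Reals_iff inner_eq_Re_cinner)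

abbreviation R :: "'h set" where "R \<equiv> closure (range A)"

lemma subspace_R: "subspace R"
proof (rule subspaceI)
  show "0 \<in> R"
    using closure_subset[of "range A"] blinfun.zero_right[of A] by (metis rangeI subsetD)
next
  fix u v assume u: "u \<in> R" and v: "v \<in> R"
  obtain f where f: "\<And>n. f n \<in> range A" "f \<longlonglongrightarrow> u"
    using u closure_sequential[of u] by metis
  obtain g where g: "\<And>n. g n \<in> range A" "g \<longlonglongrightarrow> v"
    using v closure_sequential[of v] by metis
  have "f n + g n \<in> range A" for n
    using f(1)[of n] g(1)[of n] by (auto simp flip: blinfun.add_right)
  with tendsto_add[OF f(2) g(2)] show "u + v \<in> R"
    unfolding closure_sequential by (intro exI[of _ "\<lambda>n. f n + g n"]) auto
next
  fix r and u assume u: "u \<in> R"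
  obtain f where f: "\<And>n. f n \<in> range A" "f \<longlonglongrightarrow> u"
    using u closure_sequential[of u] by metis
  have "r *\<^sub>R f n \<in> range A" for n
    using f(1)[of n] by (auto simp flip: blinfun.scaleR_right)
  with tendsto_scaleR[OF tendsto_const f(2)] show "r *\<^sub>R u \<in> R"
    unfolding closure_sequential by (intro exI[of _ "\<lambda>n. r *\<^sub>R f n"]) auto
qed

lemma scaleC_in_R:
  assumes "u \<in> R"
  shows "c *\<^sub>C u \<in> R"
proof -
  have "scaleC c ` R \<subseteq> R"
  proof (rule image_closure_subset)
    show "continuous_on R (scaleC c :: 'h \<Rightarrow> 'h)"
      using linear_continuous_on[OF bounded_linear_scaleC] .
    show "scaleC c ` range A \<subseteq> R"
      using closure_subset[of "range A"] by (auto simp flip: A_scaleC)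
  qed simp
  with assms show ?thesis by blast
qed

text \<open>The kernel of the selfadjoint operator \<open>A\<close> is orthogonal to its range.\<close>

lemma A_inj_on_R:
  assumes "u \<in> R" "v \<in> R" "A u = A v"
  shows "u = v"
proof -
  have "inner (u - v) (A z) = 0" for z
    using assms(3) by (simp add: blinfun.diff_right flip: inner_A_symmetric)
  then have "range A \<subseteq> {h. inner (u - v) h = 0}" by auto
  then have "R \<subseteq> {h. inner (u - v) h = 0}"
    by (rule closure_minimal) (intro closed_Collect_eq continuous_intros)
  moreover have "u - v \<in> R"
    using assms subspace_R by (simp add: subspace_diff)
  ultimately show ?thesis by auto
qed

text \<open>The vector \<open>p\<close> is the orthogonal projection of \<open>z\<close> onto \<open>R\<close>.\<close>

lemma A_preimage_in_R: "\<exists>p\<in>R. A p = A z"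
proof -
  obtain p where p: "p \<in> R" "\<And>h. h \<in> R \<Longrightarrow> inner p h = inner z h"
    using Riesz_on_closed_subspace[OF bounded_linear_inner_right subspace_R] by (metis closed_closure)
  have "inner (A p) w = inner (A z) w" for w
    using p(2)[of "A w"] closure_subset[of "range A"] by (auto simp: inner_A_symmetric)
  then have "A p = A z" using vector_eq_ldot by (metis vector_eq_rdot)
  with p(1) show ?thesis by blast
qed

lemma A_compose_eq_iff:
  assumes "T \<in> cbounded_ops" "X \<in> cbounded_ops"
  shows "A o\<^sub>L X = op_adj T o\<^sub>L A \<longleftrightarrow> A_adjoint_pair A T X"
proof -
  have "A o\<^sub>L X = op_adj T o\<^sub>L A \<longleftrightarrow> (\<forall>y. A (X y) = op_adj T (A y))"
    by (metis blinfun_apply_blinfun_compose blinfun_eqI)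
  also have "\<dots> \<longleftrightarrow> (\<forall>y x. cinner (A (X y)) x = cinner (op_adj T (A y)) x)"
    using cinner_eqI by metis
  also have "\<dots> \<longleftrightarrow> (\<forall>x y. cinner x (A (X y)) = cinner x (op_adj T (A y)))"
    by (metis cinner_commute)
  also have "\<dots> \<longleftrightarrow> (\<forall>x y. cinner (A (T x)) y = cinner (A x) (X y))"
    using assms(1) by (auto simp: cinner_A_symmetric simp flip: cinner_op_adj)
  finally show ?thesis using assms by (simp add: A_adjoint_pair_def)
qed

lemma A_adjoint_pair_sym: "A_adjoint_pair A T X \<Longrightarrow> A_adjoint_pair A X T"
  unfolding A_adjoint_pair_def by (metis cinner_A_symmetric cinner_commute)

lemma A_adjoint_pair_add:
  "A_adjoint_pair A T X \<Longrightarrow> A_adjoint_pair A S Y \<Longrightarrow> A_adjoint_pair A (T + S) (X + Y)"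
  by (simp add: A_adjoint_pair_def cbounded_ops_add blinfun.add_left blinfun.add_right
      cinner_add_left cinner_add_right)

lemma A_adjoint_pair_scaleC:
  "A_adjoint_pair A T X \<Longrightarrow> A_adjoint_pair A (op_scaleC c T) (op_scaleC (cnj c) X)"
  by (simp add: A_adjoint_pair_def cbounded_ops_scaleC op_scaleC.rep_eq A_scaleC
      cinner_scaleC_left cinner_scaleC_right)

lemma A_adjoint_pair_compose:
  "A_adjoint_pair A T X \<Longrightarrow> A_adjoint_pair A S Y \<Longrightarrow> A_adjoint_pair A (T o\<^sub>L S) (Y o\<^sub>L X)"
  by (simp add: A_adjoint_pair_def cbounded_ops_compose)

lemma A_adjoint_pair_imp_B_A:
  assumes "A_adjoint_pair A T X"
  shows "T \<in> B_A A"
proof -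
  have "T \<in> cbounded_ops" "X \<in> cbounded_ops"
    using assms by (auto simp: A_adjoint_pair_def)
  with assms have "A o\<^sub>L X = op_adj T o\<^sub>L A"
    by (simp add: A_compose_eq_iff)
  then have "range (blinfun_apply (op_adj T o\<^sub>L A)) = range (blinfun_apply (A o\<^sub>L X))" by simp
  also have "\<dots> \<subseteq> range A" by auto
  finally show ?thesis using \<open>T \<in> cbounded_ops\<close> by (simp add: B_A_def)
qed

text \<open>Douglas' range inclusion theorem in the case needed here. The operator \<open>X\<close> solves \<open>A X = T\<^sup>* A\<close>
  pointwise inside \<open>R\<close>, where the solution is unique, hence linear in the argument. It is bounded
  by the argument of Hellinger and Toeplitz: \<open>\<langle>X x, A z\<rangle> = \<langle>x, A T z\<rangle>\<close>, so the functionals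
  \<open>\<langle>\<cdot>, A T z\<rangle>\<close> with \<open>\<parallel>A z\<parallel> \<le> 1\<close> are pointwise, and therefore uniformly, bounded.\<close>

lemma B_A_imp_A_adjoint_pair:
  assumes T: "T \<in> B_A A"
  shows "\<exists>X. A_adjoint_pair A T X \<and> range (blinfun_apply X) \<subseteq> R"
proof -
  have Tc: "T \<in> cbounded_ops" using T by (simp add: B_A_def)
  have "\<exists>u\<in>R. A u = op_adj T (A x)" for x
  proof -
    have "op_adj T (A x) \<in> range A"
      using T by (auto simp: B_A_def subset_iff)
    then obtain z where "op_adj T (A x) = A z" by blast
    then show ?thesis using A_preimage_in_R[of z] by auto
  qed
  then obtain g where g: "g x \<in> R" "A (g x) = op_adj T (A x)" for x by metis
  have inner_g: "inner (g x) (A z) = inner x (A (T z))" for x z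
    using cinner_op_adj[OF Tc, of z "A x"] g(2)[of x]
    by (metis cinner_A_symmetric cinner_commute inner_eq_Re_cinner)
  define I where "I = {z. norm (A z) \<le> 1}"
  obtain C where C: "\<bar>inner x (A (T z))\<bar> \<le> C * norm x" if "z \<in> I" for z x
  proof (rule uniform_boundedness[of I "\<lambda>z x. inner x (A (T z))"])
    show "bounded_linear (\<lambda>x. inner x (A (T z)))" for z
      by (rule bounded_linear_inner_left)
    have "\<bar>inner x (A (T z))\<bar> \<le> norm (g x)" if "z \<in> I" for x z
    proof -
      have "\<bar>inner (g x) (A z)\<bar> \<le> norm (g x) * norm (A z)" by (rule Cauchy_Schwarz_ineq2)
      also have "\<dots> \<le> norm (g x) * 1" using that by (intro mult_left_mono) (auto simp: I_def)
      finally show ?thesis by (simp add: inner_g)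
    qed
    then show "\<exists>K. \<forall>z\<in>I. \<bar>inner x (A (T z))\<bar> \<le> K" for x by blast
  qed blast
  have range_bound: "inner (g x) (A z) \<le> C * norm x * norm (A z)" for x z
  proof (cases "A z = 0")
    case False
    define s where "s = inverse (norm (A z))"
    have s: "s > 0" using False by (simp add: s_def)
    have "s *\<^sub>R z \<in> I" using False by (simp add: I_def s_def blinfun.scaleR_right)
    from C[OF this, of x] have "\<bar>s * inner (g x) (A z)\<bar> \<le> C * norm x"
      by (simp add: inner_g blinfun.scaleR_right)
    then have "s * inner (g x) (A z) \<le> C * norm x" by linarith
    then show ?thesis using False by (simp add: s_def field_simps)
  qed simp
  have "bounded_linear g"
  proof (rule bounded_linear_intro[where K = C])
    show "g (x + y) = g x + g y" for x y
      by (rule A_inj_on_R) (simp_all add: g subspace_add[OF subspace_R] blinfun.add_right)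
    show "g (r *\<^sub>R x) = r *\<^sub>R g x" for r x
      by (rule A_inj_on_R) (simp_all add: g subspace_scale[OF subspace_R] blinfun.scaleR_right)
    show "norm (g x) \<le> norm x * C" for x
    proof -
      have "R \<subseteq> {h. inner (g x) h \<le> C * norm x * norm h}"
        by (rule closure_minimal) (auto intro!: range_bound closed_Collect_le continuous_intros)
      then have "inner (g x) (g x) \<le> C * norm x * norm (g x)" using g(1) by blast
      then have "norm (g x) * norm (g x) \<le> C * norm x * norm (g x)"
        by (simp add: power2_norm_eq_inner flip: power2_eq_square)
      then show ?thesis
        using abs_ge_zero[THEN order_trans, OF C, of 0 x]
        by (cases "norm (g x) = 0") (auto simp: mult_ac I_def)
    qed
  qed
  define X where "X = Blinfun g"
  have X: "blinfun_apply X = g"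
    unfolding X_def using \<open>bounded_linear g\<close> by (rule bounded_linear_Blinfun_apply)
  have "g (c *\<^sub>C x) = c *\<^sub>C g x" for c x
    by (rule A_inj_on_R) (simp_all add: g scaleC_in_R A_scaleC cbounded_opsD[OF op_adj_cbounded[OF Tc]])
  then have Xc: "X \<in> cbounded_ops" by (simp add: cbounded_ops_def X)
  have "A o\<^sub>L X = op_adj T o\<^sub>L A"
    by (rule blinfun_eqI) (simp add: X g)
  then have "A_adjoint_pair A T X" by (simp add: A_compose_eq_iff Tc Xc)
  moreover have "range (blinfun_apply X) \<subseteq> R" using g(1) by (auto simp: X)
  ultimately show ?thesis by blast
qed

lemma A_adj_eqI:
  assumes "A_adjoint_pair A T X" "range (blinfun_apply X) \<subseteq> R"
  shows "A_adj A T = X"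
  unfolding A_adj_def
proof (rule the_equality)
  have T: "T \<in> cbounded_ops" and X: "X \<in> cbounded_ops"
    using assms(1) by (auto simp: A_adjoint_pair_def)
  then have AX: "A o\<^sub>L X = op_adj T o\<^sub>L A" using assms(1) by (simp add: A_compose_eq_iff)
  with X assms(2) show "X \<in> cbounded_ops \<and> A o\<^sub>L X = op_adj T o\<^sub>L A \<and> range (blinfun_apply X) \<subseteq> R"
    by blast
  fix Y assume Y: "Y \<in> cbounded_ops \<and> A o\<^sub>L Y = op_adj T o\<^sub>L A \<and> range (blinfun_apply Y) \<subseteq> R"
  have "Y x = X x" for x
  proof (rule A_inj_on_R)
    show "A (Y x) = A (X x)" using Y AX by (metis blinfun_apply_blinfun_compose)
  qed (use Y assms(2) in auto)
  then show "Y = X" by (rule blinfun_eqI)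
qed

lemma A_adj:
  assumes "T \<in> B_A A"
  shows A_adjoint_pair_A_adj: "A_adjoint_pair A T (A_adj A T)"
    and range_A_adj: "range (blinfun_apply (A_adj A T)) \<subseteq> R"
  using B_A_imp_A_adjoint_pair[OF assms] A_adj_eqI by blast+

lemma A_adj_in_B_A: "T \<in> B_A A \<Longrightarrow> A_adj A T \<in> B_A A"
  using A_adjoint_pair_A_adj A_adjoint_pair_sym A_adjoint_pair_imp_B_A by blast

lemma B_A_cbounded: "T \<in> B_A A \<Longrightarrow> T \<in> cbounded_ops"
  by (simp add: B_A_def)

lemma B_A_add: "T \<in> B_A A \<Longrightarrow> S \<in> B_A A \<Longrightarrow> T + S \<in> B_A A"
  using A_adjoint_pair_A_adj A_adjoint_pair_add A_adjoint_pair_imp_B_A by blast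

lemma B_A_scaleC: "T \<in> B_A A \<Longrightarrow> op_scaleC c T \<in> B_A A"
  using A_adjoint_pair_A_adj A_adjoint_pair_scaleC A_adjoint_pair_imp_B_A by blast

lemma B_A_compose: "T \<in> B_A A \<Longrightarrow> S \<in> B_A A \<Longrightarrow> T o\<^sub>L S \<in> B_A A"
  using A_adjoint_pair_A_adj A_adjoint_pair_compose A_adjoint_pair_imp_B_A by blast

lemma A_adj_add:
  assumes "T \<in> B_A A" "S \<in> B_A A"
  shows "A_adj A (T + S) = A_adj A T + A_adj A S"
proof (rule A_adj_eqI)
  show "A_adjoint_pair A (T + S) (A_adj A T + A_adj A S)"
    using assms by (intro A_adjoint_pair_add A_adjoint_pair_A_adj)
  show "range (blinfun_apply (A_adj A T + A_adj A S)) \<subseteq> R"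
    using range_A_adj[OF assms(1)] range_A_adj[OF assms(2)] subspace_R
    by (auto simp: blinfun.add_left intro!: subspace_add)
qed

lemma A_adj_scaleC:
  assumes "T \<in> B_A A"
  shows "A_adj A (op_scaleC c T) = op_scaleC (cnj c) (A_adj A T)"
proof (rule A_adj_eqI)
  show "A_adjoint_pair A (op_scaleC c T) (op_scaleC (cnj c) (A_adj A T))"
    using assms by (intro A_adjoint_pair_scaleC A_adjoint_pair_A_adj)
  show "range (blinfun_apply (op_scaleC (cnj c) (A_adj A T))) \<subseteq> R"
    using range_A_adj[OF assms] by (auto simp: op_scaleC.rep_eq intro!: scaleC_in_R)
qed

lemma A_adj_compose:
  assumes "T \<in> B_A A" "S \<in> B_A A"
  shows "A_adj A (T o\<^sub>L S) = A_adj A S o\<^sub>L A_adj A T"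
proof (rule A_adj_eqI)
  show "A_adjoint_pair A (T o\<^sub>L S) (A_adj A S o\<^sub>L A_adj A T)"
    using assms by (intro A_adjoint_pair_compose A_adjoint_pair_A_adj)
  show "range (blinfun_apply (A_adj A S o\<^sub>L A_adj A T)) \<subseteq> R"
    using range_A_adj[OF assms(2)] by auto
qed

text \<open>In general the second adjoint of \<open>T\<close> differs from \<open>T\<close>, since its range is forced into \<open>R\<close>.
  From the first adjoint on, the range condition already holds, and taking adjoints is an
  involution.\<close>

lemma A_adj_A_adj_A_adj:
  assumes "T \<in> B_A A"
  shows "A_adj A (A_adj A (A_adj A T)) = A_adj A T"
proof (rule A_adj_eqI)
  show "A_adjoint_pair A (A_adj A (A_adj A T)) (A_adj A T)"
    by (rule A_adjoint_pair_sym[OF A_adjoint_pair_A_adj[OF A_adj_in_B_A[OF assms]]])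
qed (rule range_A_adj[OF assms])

section \<open>Operators with an A-adjoint are bounded for the seminorm of A\<close>

lemma A_norm_eq: "A_norm A x = sqrt (inner (A x) x)"
  by (simp add: A_norm_def inner_eq_Re_cinner)

lemma A_norm_nonneg: "0 \<le> A_norm A x"
  by (simp add: A_norm_eq inner_A_nonneg)

lemma A_norm_squared: "(A_norm A x)\<^sup>2 = inner (A x) x"
  by (simp add: A_norm_eq inner_A_nonneg)

lemma A_Cauchy_Schwarz: "inner (A x) y \<le> A_norm A x * A_norm A y"
proof -
  let ?a = "inner (A x) x" and ?b = "inner (A x) y" and ?c = "inner (A y) y"
  have q: "0 \<le> ?a + 2 * t * ?b + t\<^sup>2 * ?c" for t
  proof -
    have "inner (A y) x = ?b" by (metis inner_A_symmetric inner_commute)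
    then show ?thesis
      using inner_A_nonneg[of "x + t *\<^sub>R y"]
      by (simp add: blinfun.add_right blinfun.scaleR_right inner_add_left inner_add_right
          power2_eq_square algebra_simps)
  qed
  have "?b\<^sup>2 \<le> ?a * ?c"
  proof (cases "?c = 0")
    case True
    \<comment> \<open>The quadratic polynomial \<open>q\<close> degenerates to an affine one, which is bounded below only if it is
      constant; the chosen \<open>t\<close> makes it \<open>- 1\<close>.\<close>
    have "?b = 0"
    proof (rule ccontr)
      assume "?b \<noteq> 0"
      then show False using q[of "- (?a + 1) / (2 * ?b)"] True by (simp add: field_simps)
    qed
    then show ?thesis using True by simp
  next
    case False
    then have "?c > 0" using inner_A_nonneg[of y] by simp
    then show ?thesis using q[of "- ?b / ?c"] by (simp add: field_simps power2_eq_square)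
  qed
  then have "?b\<^sup>2 \<le> (A_norm A x * A_norm A y)\<^sup>2"
    by (simp add: power_mult_distrib A_norm_squared)
  then show ?thesis
    by (rule power2_le_imp_le) (simp add: A_norm_nonneg)
qed

end

text \<open>A log-convex sequence grows at least like the powers of its first ratio \<open>a 1 / a 0\<close>.\<close>

lemma log_convex_first_ratio:
  fixes a :: "nat \<Rightarrow> real"
  assumes nonneg: "\<And>n. 0 \<le> a n"
    and log_convex: "\<And>n. (a (Suc n))\<^sup>2 \<le> a n * a (Suc (Suc n))"
    and growth: "\<And>n. a n \<le> C * v ^ n" and v: "v > 0"
  shows "a 1 \<le> v * a 0"
proof (cases "a 1 = 0")
  case True
  then show ?thesis using nonneg v by simp
next
  case False
  then have a1: "a 1 > 0" using nonneg[of 1] by simp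
  have "a 0 \<noteq> 0"
    using log_convex[of 0] False by auto
  then have a0: "a 0 > 0" using nonneg[of 0] by simp
  define r where "r = a 1 / a 0"
  have r: "r > 0" using a0 a1 by (simp add: r_def)
  have step: "a n > 0 \<and> r * a n \<le> a (Suc n)" for n
  proof (induction n)
    case 0
    then show ?case using a0 by (simp add: r_def)
  next
    case (Suc n)
    then have p: "a (Suc n) > 0" using r by (meson less_le_trans mult_pos_pos)
    have "(r * a n) * a (Suc n) \<le> a (Suc n) * a (Suc n)"
      using Suc p by (intro mult_right_mono) auto
    also have "\<dots> \<le> a n * a (Suc (Suc n))" using log_convex[of n] by (simp add: power2_eq_square)
    finally have "a n * (r * a (Suc n)) \<le> a n * a (Suc (Suc n))" by (simp add: mult_ac)
    then show ?case using Suc p by simp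
  qed
  have pow: "a 0 * r ^ n \<le> a n" for n
  proof (induction n)
    case (Suc n)
    have "a 0 * r ^ Suc n = r * (a 0 * r ^ n)" by simp
    also have "\<dots> \<le> r * a n" using Suc r by (intro mult_left_mono) auto
    finally show ?case using step[of n] by linarith
  qed simp
  have "r \<le> v"
  proof (rule ccontr)
    assume "\<not> r \<le> v"
    then have "1 < r / v" using v by simp
    then obtain n where n: "C / a 0 < (r / v) ^ n" using real_arch_pow by blast
    have "a 0 * r ^ n \<le> C * v ^ n" using pow[of n] growth[of n] by linarith
    then have "(r / v) ^ n \<le> C / a 0" using a0 v by (simp add: field_simps power_divide)
    with n show False by simp
  qed
  then show ?thesis using a0 by (simp add: r_def field_simps)
qed

context positive_operator
begin

text \<open>Put \<open>V = X T\<close> with \<open>X\<close> adjoint to \<open>T\<close>; then \<open>V\<close> is its own adjoint for the semi-inner product. By the Cauchy--Schwarz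
  inequality \<open>\<parallel>T x\<parallel>\<^sub>A\<^sup>2 = \<langle>A x, V x\<rangle> \<le> \<parallel>x\<parallel>\<^sub>A \<parallel>V x\<parallel>\<^sub>A\<close>, and likewise the numbers \<open>\<parallel>V\<^sup>n x\<parallel>\<^sub>A\<close> form a
  log-convex sequence. It grows at most like \<open>\<parallel>V\<parallel>\<^sup>n\<close>, hence \<open>\<parallel>V x\<parallel>\<^sub>A \<le> \<parallel>V\<parallel> \<parallel>x\<parallel>\<^sub>A\<close>.\<close>

lemma B_A_subset_B_A_half:
  assumes T: "T \<in> B_A A"
  shows "T \<in> B_A_half A"
proof -
  obtain X where TX: "A_adjoint_pair A T X" using A_adjoint_pair_A_adj[OF T] by blast
  define V where "V = X o\<^sub>L T"
  have V: "inner (A (V x)) y = inner (A x) (V y)" for x y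
    using A_adjoint_pair_compose[OF A_adjoint_pair_sym[OF TX] TX]
    by (simp add: A_adjoint_pair_def V_def inner_eq_Re_cinner)
  \<comment> \<open>A bound for the norm of \<open>V\<close> that is positive even if \<open>V = 0\<close>.\<close>
  define v where "v = norm V + 1"
  have v: "v > 0" by (simp add: v_def add_nonneg_pos)
  have V_bound: "A_norm A (V x) \<le> v * A_norm A x" for x
  proof -
    define a where "a n = A_norm A ((blinfun_apply V ^^ n) x)" for n
    have "a 1 \<le> v * a 0"
    proof (rule log_convex_first_ratio[where C = "sqrt (norm A) * norm x"])
      show "0 \<le> a n" for n by (simp add: a_def A_norm_nonneg)
      show "(a (Suc n))\<^sup>2 \<le> a n * a (Suc (Suc n))" for n
        unfolding a_def A_norm_squared
        using A_Cauchy_Schwarz[of "(blinfun_apply V ^^ n) x" "(blinfun_apply V ^^ Suc (Suc n)) x"]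
        by (simp add: V)
      show "a n \<le> sqrt (norm A) * norm x * v ^ n" for n
      proof -
        have "norm ((blinfun_apply V ^^ n) x) \<le> v ^ n * norm x"
        proof (induction n)
          case (Suc n)
          have "norm ((blinfun_apply V ^^ Suc n) x) \<le> norm V * norm ((blinfun_apply V ^^ n) x)"
            by (simp add: norm_blinfun)
          also have "\<dots> \<le> v * (v ^ n * norm x)"
            using Suc v by (intro mult_mono) (auto simp: v_def)
          finally show ?case by (simp add: mult_ac)
        qed simp
        moreover have "A_norm A y \<le> sqrt (norm A) * norm y" for y
        proof -
          have "inner (A y) y \<le> norm (A y) * norm y" by (rule norm_cauchy_schwarz)
          also have "\<dots> \<le> norm A * norm y * norm y" by (intro mult_right_mono norm_blinfun) simp
          finally have "A_norm A y \<le> sqrt (norm A * (norm y)\<^sup>2)"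
            unfolding A_norm_eq by (intro real_sqrt_le_mono) (simp add: power2_eq_square mult_ac)
          then show ?thesis by (simp add: real_sqrt_mult)
        qed
        ultimately show ?thesis unfolding a_def
          by (smt (verit) mult.assoc mult.commute mult_left_mono norm_ge_zero real_sqrt_ge_zero)
      qed
    qed (rule v)
    then show ?thesis by (simp add: a_def)
  qed
  have "A_norm A (T x) \<le> sqrt v * A_norm A x" for x
  proof -
    have "(A_norm A (T x))\<^sup>2 = inner (A x) (V x)"
      using TX by (simp add: A_norm_squared A_adjoint_pair_def V_def inner_eq_Re_cinner)
    also have "\<dots> \<le> A_norm A x * A_norm A (V x)" by (rule A_Cauchy_Schwarz)
    also have "\<dots> \<le> A_norm A x * (v * A_norm A x)"
      by (intro mult_left_mono V_bound A_norm_nonneg)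
    also have "\<dots> = (sqrt v * A_norm A x)\<^sup>2"
      using v by (simp add: power_mult_distrib power2_eq_square mult_ac)
    finally show ?thesis
      by (rule power2_le_imp_le) (use v in \<open>simp add: A_norm_nonneg\<close>)
  qed
  then have "\<exists>c>0. \<forall>x. A_norm A (T x) \<le> c * A_norm A x"
    using v by (intro exI[of _ "sqrt v"]) auto
  then show ?thesis using B_A_cbounded[OF T] by (simp add: B_A_half_def)
qed

end

section \<open>The numerical radius of an A-selfadjoint invariant seminorm\<close>

locale A_selfadjoint_seminorm = positive_operator A
  for A :: "'h::chilbert_space \<Rightarrow>\<^sub>L 'h" +
  fixes N :: "('h \<Rightarrow>\<^sub>L 'h) \<Rightarrow> real"
  assumes seminorm: "seminorm_on (B_A_half A) N"
    and selfadjoint_invariant: "A_selfadjoint_invariant A N"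
begin

abbreviation num_radius :: "('h \<Rightarrow>\<^sub>L 'h) \<Rightarrow> real" where
  "num_radius \<equiv> A_num_radius A N"

lemma N_nonneg: "T \<in> B_A A \<Longrightarrow> 0 \<le> N T"
  and N_scaleC: "T \<in> B_A A \<Longrightarrow> N (op_scaleC c T) = cmod c * N T"
  and N_add: "T \<in> B_A A \<Longrightarrow> S \<in> B_A A \<Longrightarrow> N (T + S) \<le> N T + N S"
  and N_A_adj: "T \<in> B_A A \<Longrightarrow> N (A_adj A T) = N T"
  using seminorm selfadjoint_invariant B_A_subset_B_A_half
  unfolding seminorm_on_def A_selfadjoint_invariant_def by (metis, metis, metis, metis)

lemma B_A_diff: "T \<in> B_A A \<Longrightarrow> S \<in> B_A A \<Longrightarrow> T - S \<in> B_A A"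
  using B_A_add[OF _ B_A_scaleC[of S "- 1"], of T] by (simp add: op_scaleC_neg_one)

lemma A_Re_in_B_A: "T \<in> B_A A \<Longrightarrow> A_Re A T \<in> B_A A"
  by (simp add: A_Re_def scaleR_op_scaleC B_A_scaleC B_A_add A_adj_in_B_A)

lemma A_Re_add: "T \<in> B_A A \<Longrightarrow> S \<in> B_A A \<Longrightarrow> A_Re A (T + S) = A_Re A T + A_Re A S"
  by (simp add: A_Re_def A_adj_add scaleR_add_right)

lemma A_Re_A_adj: "T \<in> B_A A \<Longrightarrow> A_Re A (A_adj A T) = A_adj A (A_Re A T)"
  by (simp add: A_Re_def scaleR_op_scaleC A_adj_scaleC A_adj_add A_adj_in_B_A B_A_add)

lemma N_A_Re_le: "T \<in> B_A A \<Longrightarrow> N (A_Re A T) \<le> N T"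
  using N_add[of T "A_adj A T"]
  by (simp add: A_Re_def scaleR_op_scaleC N_scaleC B_A_add A_adj_in_B_A N_A_adj)

lemma N_A_Re_A_adj: "T \<in> B_A A \<Longrightarrow> N (A_Re A (A_adj A T)) = N (A_Re A T)"
  by (simp add: A_Re_A_adj N_A_adj A_Re_in_B_A)

lemma N_A_Re_le_num_radius:
  assumes T: "T \<in> B_A A" and c: "cmod c = 1"
  shows "N (A_Re A (op_scaleC c T)) \<le> num_radius T"
proof -
  have "c = exp (\<i> * complex_of_real (Arg c))"
    using c Arg_eq[of c] by force
  moreover have "bdd_above (range (\<lambda>\<theta>::real. N (A_Re A (op_scaleC (exp (\<i> * complex_of_real \<theta>)) T))))"
  proof (rule bdd_aboveI2)
    show "N (A_Re A (op_scaleC (exp (\<i> * complex_of_real \<theta>)) T)) \<le> N T" for \<theta>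
      using N_A_Re_le[OF B_A_scaleC[OF T]] by (metis N_scaleC[OF T] mult_1 norm_exp_i_times)
  qed
  ultimately show ?thesis
    unfolding A_num_radius_def by (metis (no_types, lifting) UNIV_I cSUP_upper)
qed

lemma num_radius_least:
  assumes "\<And>c. cmod c = 1 \<Longrightarrow> N (A_Re A (op_scaleC c T)) \<le> b"
  shows "num_radius T \<le> b"
  unfolding A_num_radius_def by (rule cSUP_least) (auto intro: assms)

lemma num_radius_rotate_le:
  assumes T: "T \<in> B_A A" and d: "cmod d = 1"
  shows "num_radius T \<le> num_radius (op_scaleC d T)"
proof (rule num_radius_least)
  fix c :: complex assume c: "cmod c = 1"
  have "c * cnj d * d = c"
    using d by (metis complex_norm_square mult.assoc mult.commute mult_1 of_real_1 one_power2)
  moreover have "N (A_Re A (op_scaleC (c * cnj d * d) T)) \<le> num_radius (op_scaleC d T)"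
    using N_A_Re_le_num_radius[OF B_A_scaleC[OF T], of "c * cnj d" d] c d
    by (simp add: op_scaleC_op_scaleC norm_mult)
  ultimately show "N (A_Re A (op_scaleC c T)) \<le> num_radius (op_scaleC d T)" by (simp only:)
qed

lemma num_radius_A_adj:
  assumes T: "T \<in> B_A A"
  shows "num_radius (A_adj A T) = num_radius T"
proof (rule antisym)
  have "N (A_Re A (op_scaleC c (A_adj A T))) = N (A_Re A (op_scaleC (cnj c) T))" for c
    using N_A_Re_A_adj[OF B_A_scaleC[OF T, of "cnj c"]] by (simp add: A_adj_scaleC T)
  then show "num_radius (A_adj A T) \<le> num_radius T"
    by (intro num_radius_least) (simp add: N_A_Re_le_num_radius T)
  have "N (A_Re A (op_scaleC c T)) = N (A_Re A (op_scaleC (cnj c) (A_adj A T)))" for c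
    using N_A_Re_A_adj[OF B_A_scaleC[OF T, of c]] by (simp add: A_adj_scaleC T)
  then show "num_radius T \<le> num_radius (A_adj A T)"
    by (intro num_radius_least) (simp add: N_A_Re_le_num_radius A_adj_in_B_A T)
qed

lemma num_radius_midpoint:
  assumes Z: "Z \<in> B_A A" and Y: "Y \<in> B_A A"
  shows "num_radius Z \<le> 1 / 2 * num_radius (Z + Y) + 1 / 2 * num_radius (Z - Y)"
proof (rule num_radius_least)
  fix c :: complex assume c: "cmod c = 1"
  let ?U = "op_scaleC c (Z + Y)" and ?V = "op_scaleC c (Z - Y)" and ?P = "A_Re A (op_scaleC c Z)"
  have U: "?U \<in> B_A A" and V: "?V \<in> B_A A" and cZ: "op_scaleC c Z \<in> B_A A"
    using Z Y by (simp_all add: B_A_scaleC B_A_add B_A_diff)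
  have "?U + ?V = op_scaleC c Z + op_scaleC c Z"
    by (simp flip: op_scaleC_add)
  then have "A_Re A ?U + A_Re A ?V = ?P + ?P"
    using A_Re_add[OF U V] A_Re_add[OF cZ cZ] by simp
  also have "\<dots> = op_scaleC 2 ?P"
    using scaleR_op_scaleC[of 2 ?P] by (simp add: scaleR_2)
  finally have "2 * N ?P = N (A_Re A ?U + A_Re A ?V)"
    by (simp add: N_scaleC A_Re_in_B_A cZ)
  also have "\<dots> \<le> N (A_Re A ?U) + N (A_Re A ?V)"
    using U V by (intro N_add A_Re_in_B_A)
  also have "\<dots> \<le> num_radius (Z + Y) + num_radius (Z - Y)"
    using Z Y c by (intro add_mono N_A_Re_le_num_radius B_A_add B_A_diff)
  finally show "N ?P \<le> 1 / 2 * num_radius (Z + Y) + 1 / 2 * num_radius (Z - Y)" by simp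
qed

end

section \<open>Submultiplicative seminorms\<close>

locale A_submultiplicative_seminorm = A_selfadjoint_seminorm A N
  for A :: "'h::chilbert_space \<Rightarrow>\<^sub>L 'h" and N +
  assumes submultiplicative: "A_submultiplicative A N"
begin

lemma N_compose: "T \<in> B_A A \<Longrightarrow> S \<in> B_A A \<Longrightarrow> N (T o\<^sub>L S) \<le> N T * N S"
  using submultiplicative B_A_subset_B_A_half by (auto simp: A_submultiplicative_def)

text \<open>If \<open>A\<close> is the identity and \<open>P = \<Re> (c S)\<close>, then \<open>\<Re> (c (T S + S T\<^sup>*)) = T P + P T\<^sup>*\<close>. For general
  \<open>A\<close> the adjoint need not be an involution, and this identity may fail; it holds for the adjoints of
  both sides, where a third adjoint equals the first. Taking the adjoint does not change \<open>N\<close>.\<close>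

lemma num_radius_add_le:
  assumes T: "T \<in> B_A A" and S: "S \<in> B_A A"
  shows "num_radius ((T o\<^sub>L S) + (S o\<^sub>L A_adj A T)) \<le> 2 * (N T * num_radius S)"
proof (rule num_radius_least)
  fix c :: complex assume c: "cmod c = 1"
  define S' where "S' = op_scaleC c S"
  define X where "X = (T o\<^sub>L S') + (S' o\<^sub>L A_adj A T)"
  define T1 where "T1 = A_adj A T"
  define T2 where "T2 = A_adj A T1"
  define P where "P = A_adj A (A_Re A S')"
  have S': "S' \<in> B_A A" using S by (simp add: S'_def B_A_scaleC)
  have T1: "T1 \<in> B_A A" and T2: "T2 \<in> B_A A" using T by (simp_all add: T1_def T2_def A_adj_in_B_A)
  have P: "P \<in> B_A A" using S' by (simp add: P_def A_adj_in_B_A A_Re_in_B_A)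
  have X: "X \<in> B_A A" using T S' by (simp add: X_def B_A_add B_A_compose A_adj_in_B_A)
  have T3: "A_adj A T2 = T1" using T by (simp add: T1_def T2_def A_adj_A_adj_A_adj)
  have X_eq: "op_scaleC c ((T o\<^sub>L S) + (S o\<^sub>L A_adj A T)) = X"
    using B_A_cbounded[OF T]
    by (simp add: X_def S'_def op_scaleC_add op_scaleC_compose_left op_scaleC_compose_right)
  have adj1: "A_adj A X = (A_adj A S' o\<^sub>L T1) + (T2 o\<^sub>L A_adj A S')"
    using T S' T1 by (simp add: X_def A_adj_add A_adj_compose B_A_compose T2_def flip: T1_def)
  have adj2: "A_adj A (A_adj A X) = (T2 o\<^sub>L A_adj A (A_adj A S')) + (A_adj A (A_adj A S') o\<^sub>L T1)"
    using S' T1 T2 T3 unfolding adj1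
    by (simp add: A_adj_add A_adj_compose B_A_compose A_adj_in_B_A flip: T2_def)
  have P_eq: "P = (1 / 2) *\<^sub>R (A_adj A S' + A_adj A (A_adj A S'))"
    using A_Re_A_adj[OF S'] by (simp add: P_def A_Re_def)
  have "A_Re A (A_adj A X) = (T2 o\<^sub>L P) + (P o\<^sub>L T1)"
    unfolding A_Re_def adj2 unfolding adj1 P_eq
    by (rule blinfun_eqI)
      (simp add: blinfun.add_left blinfun.add_right blinfun.scaleR_left blinfun.scaleR_right
        scaleR_add_right add_ac)
  then have "N (A_Re A X) = N ((T2 o\<^sub>L P) + (P o\<^sub>L T1))"
    using N_A_Re_A_adj[OF X] by simp
  also have "\<dots> \<le> N (T2 o\<^sub>L P) + N (P o\<^sub>L T1)"
    using T1 T2 P by (intro N_add B_A_compose)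
  also have "\<dots> \<le> N T2 * N P + N P * N T1"
    using T1 T2 P by (intro add_mono N_compose)
  also have "\<dots> = 2 * (N T * N (A_Re A S'))"
    using T T1 S' by (simp add: T1_def T2_def P_def N_A_adj A_Re_in_B_A)
  also have "\<dots> \<le> 2 * (N T * num_radius S)"
    using N_A_Re_le_num_radius[OF S c] N_nonneg[OF T] by (simp add: S'_def mult_left_mono)
  finally show "N (A_Re A (op_scaleC c ((T o\<^sub>L S) + (S o\<^sub>L A_adj A T)))) \<le> 2 * (N T * num_radius S)"
    by (simp add: X_eq)
qed

text \<open>Replacing \<open>T\<close> by \<open>\<i> T\<close> turns \<open>T S + S T\<^sup>\<sharp>\<close> into \<open>\<i> (T S - S T\<^sup>\<sharp>)\<close>.\<close>

lemma num_radius_diff_le: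
  assumes T: "T \<in> B_A A" and S: "S \<in> B_A A"
  shows "num_radius ((T o\<^sub>L S) - (S o\<^sub>L A_adj A T)) \<le> 2 * (N T * num_radius S)"
proof -
  let ?Y = "S o\<^sub>L A_adj A T"
  have "op_scaleC \<i> ((T o\<^sub>L S) - ?Y) = op_scaleC \<i> (T o\<^sub>L S) + op_scaleC \<i> (op_scaleC (- 1) ?Y)"
    by (simp add: op_scaleC_neg_one flip: op_scaleC_add)
  also have "\<dots> = (op_scaleC \<i> T o\<^sub>L S) + (S o\<^sub>L A_adj A (op_scaleC \<i> T))"
    using B_A_cbounded[OF S] T
    by (simp add: op_scaleC_op_scaleC A_adj_scaleC op_scaleC_compose_left op_scaleC_compose_right)
  finally have "num_radius (op_scaleC \<i> ((T o\<^sub>L S) - ?Y)) \<le> 2 * (N T * num_radius S)"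
    using num_radius_add_le[OF B_A_scaleC[OF T] S, of \<i>] by (simp add: N_scaleC T)
  moreover have "(T o\<^sub>L S) - ?Y \<in> B_A A"
    using T S by (simp add: B_A_diff B_A_compose A_adj_in_B_A)
  ultimately show ?thesis
    using num_radius_rotate_le[of _ \<i>] by fastforce
qed

lemma num_radius_compose_le:
  assumes T: "T \<in> B_A A" and S: "S \<in> B_A A"
  shows "num_radius (T o\<^sub>L S)
      \<le> N T * num_radius S + 1 / 2 * num_radius ((T o\<^sub>L S) + (S o\<^sub>L A_adj A T))"
    and "num_radius (T o\<^sub>L S)
      \<le> N T * num_radius S + 1 / 2 * num_radius ((T o\<^sub>L S) - (S o\<^sub>L A_adj A T))"
proof -
  have "T o\<^sub>L S \<in> B_A A" "S o\<^sub>L A_adj A T \<in> B_A A"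
    using T S by (simp_all add: B_A_compose A_adj_in_B_A)
  note num_radius_midpoint[OF this]
  with num_radius_add_le[OF T S] num_radius_diff_le[OF T S]
  show "num_radius (T o\<^sub>L S)
      \<le> N T * num_radius S + 1 / 2 * num_radius ((T o\<^sub>L S) + (S o\<^sub>L A_adj A T))"
    and "num_radius (T o\<^sub>L S)
      \<le> N T * num_radius S + 1 / 2 * num_radius ((T o\<^sub>L S) - (S o\<^sub>L A_adj A T))"
    by linarith+
qed

text \<open>These are the inequalities for \<open>S\<^sup>\<sharp>\<close> and \<open>T\<^sup>\<sharp>\<close> in place of \<open>T\<close> and \<open>S\<close>, because
  \<open>(T S \<plusminus> S\<^sup>\<sharp> T)\<^sup>\<sharp> = S\<^sup>\<sharp> T\<^sup>\<sharp> \<plusminus> T\<^sup>\<sharp> S\<^sup>\<sharp>\<^sup>\<sharp>\<close> and neither the seminorm nor the numerical radius changes under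
  the adjoint.\<close>

lemma num_radius_compose_le':
  assumes T: "T \<in> B_A A" and S: "S \<in> B_A A"
  shows "num_radius (T o\<^sub>L S)
      \<le> N S * num_radius T + 1 / 2 * num_radius ((T o\<^sub>L S) + (A_adj A S o\<^sub>L T))"
    and "num_radius (T o\<^sub>L S)
      \<le> N S * num_radius T + 1 / 2 * num_radius ((T o\<^sub>L S) - (A_adj A S o\<^sub>L T))"
proof -
  let ?T = "A_adj A T" and ?S = "A_adj A S"
  have T': "?T \<in> B_A A" and S': "?S \<in> B_A A" using T S by (simp_all add: A_adj_in_B_A)
  have TS: "T o\<^sub>L S \<in> B_A A" and Y: "?S o\<^sub>L T \<in> B_A A"
    using T S S' by (simp_all add: B_A_compose)
  have adj_TS: "A_adj A (T o\<^sub>L S) = ?S o\<^sub>L ?T" and adj_Y: "A_adj A (?S o\<^sub>L T) = ?T o\<^sub>L A_adj A ?S"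
    using T S S' by (simp_all add: A_adj_compose)
  have "A_adj A ((T o\<^sub>L S) + (?S o\<^sub>L T)) = (?S o\<^sub>L ?T) + (?T o\<^sub>L A_adj A ?S)"
    using A_adj_add[OF TS Y] by (simp add: adj_TS adj_Y)
  then have plus: "num_radius ((?S o\<^sub>L ?T) + (?T o\<^sub>L A_adj A ?S)) = num_radius ((T o\<^sub>L S) + (?S o\<^sub>L T))"
    using num_radius_A_adj[OF B_A_add[OF TS Y]] by simp
  have "A_adj A ((T o\<^sub>L S) - (?S o\<^sub>L T)) = (?S o\<^sub>L ?T) - (?T o\<^sub>L A_adj A ?S)"
    using A_adj_add[OF TS B_A_scaleC[OF Y, of "- 1"]] A_adj_scaleC[OF Y, of "- 1"]
    by (simp add: adj_TS adj_Y op_scaleC_neg_one)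
  then have minus: "num_radius ((?S o\<^sub>L ?T) - (?T o\<^sub>L A_adj A ?S)) = num_radius ((T o\<^sub>L S) - (?S o\<^sub>L T))"
    using num_radius_A_adj[OF B_A_diff[OF TS Y]] by simp
  have TS_eq: "num_radius (?S o\<^sub>L ?T) = num_radius (T o\<^sub>L S)"
    using num_radius_A_adj[OF TS] by (simp add: adj_TS)
  show "num_radius (T o\<^sub>L S)
      \<le> N S * num_radius T + 1 / 2 * num_radius ((T o\<^sub>L S) + (?S o\<^sub>L T))"
    and "num_radius (T o\<^sub>L S)
      \<le> N S * num_radius T + 1 / 2 * num_radius ((T o\<^sub>L S) - (?S o\<^sub>L T))"
    using num_radius_compose_le[OF S' T'] unfolding plus minus TS_eq
    by (simp_all add: N_A_adj num_radius_A_adj T S)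
qed

end

theorem theorem3p3:
  fixes A T S :: "'h::chilbert_space \<Rightarrow>\<^sub>L 'h"
    and N :: "('h \<Rightarrow>\<^sub>L 'h) \<Rightarrow> real"
  assumes "positive_op A" and "A \<noteq> 0"
    and "T \<in> B_A A" and "S \<in> B_A A"
    and "seminorm_on (B_A_half A) N"
    and "A_selfadjoint_invariant A N"
    and "A_submultiplicative A N"
  shows "A_num_radius A N (T o\<^sub>L S)
        \<le> N T * A_num_radius A N S + 1 / 2 * A_num_radius A N ((T o\<^sub>L S) + (S o\<^sub>L A_adj A T))
    \<and> A_num_radius A N (T o\<^sub>L S)
        \<le> N T * A_num_radius A N S + 1 / 2 * A_num_radius A N ((T o\<^sub>L S) - (S o\<^sub>L A_adj A T))
    \<and> A_num_radius A N (T o\<^sub>L S)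
        \<le> N S * A_num_radius A N T + 1 / 2 * A_num_radius A N ((T o\<^sub>L S) + (A_adj A S o\<^sub>L T))
    \<and> A_num_radius A N (T o\<^sub>L S)
        \<le> N S * A_num_radius A N T + 1 / 2 * A_num_radius A N ((T o\<^sub>L S) - (A_adj A S o\<^sub>L T))"
proof -
  interpret A_submultiplicative_seminorm A N
    by standard fact+
  show ?thesis
    using num_radius_compose_le[OF \<open>T \<in> B_A A\<close> \<open>S \<in> B_A A\<close>]
      num_radius_compose_le'[OF \<open>T \<in> B_A A\<close> \<open>S \<in> B_A A\<close>] by blast
qed

end
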